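(* Let $p,q\in\mathbb N$. There exists a Cantor set $Z$ and a continuous surjection $g\colon Z\to Z$ such that the set of fundamental periods of periodic points of the induced map $2^g$ is exactly $$\mathrm{Per}(2^g)=\{m\in\mathbb N: m\mid p\ \text{or}\ m\mid q\}.$$
   Context: $2^Z$ is the space of nonempty closed subsets of $Z$ with the Hausdorff metric, and $2^g(C)=g(C)$. $\mathrm{Per}(2^g)$ is the set of all $k\in\mathbb N$ such that some $C\in 2^Z$ has fundamental (least) period $k$ under $2^g$. *)

theory Defs
  imports "HOL-Analysis.Analysis"
begin

definition cantor_set :: "'a::metric_space set \<Rightarrow> bool" where
  "cantor_set Z \<longleftrightarrow> Z \<noteq> {} \<and> compact Z \<and> (\<forall>x\<in>Z. x islimpt Z)
     \<and> (\<forall>x\<in>Z. connected_component_set Z x = {x})"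

definition hyperspace :: "'a::metric_space set \<Rightarrow> 'a set set" where
  "hyperspace Z = {C. C \<noteq> {} \<and> C \<subseteq> Z \<and> closed C}"

definition induced_map :: "('a \<Rightarrow> 'a) \<Rightarrow> 'a set \<Rightarrow> 'a set" where
  "induced_map g C = g ` C"

definition Per_induced :: "'a::metric_space set \<Rightarrow> ('a \<Rightarrow> 'a) \<Rightarrow> nat set" where
  "Per_induced Z g = {k. k \<ge> 1 \<and> (\<exists>C\<in>hyperspace Z.
      (induced_map g ^^ k) C = C \<and> (\<forall>j. 1 \<le> j \<and> j < k \<longrightarrow> (induced_map g ^^ j) C \<noteq> C))}"

end

theory Submission
  imports Defs
begin

text \<open>The system is a one-sided subshift. Let \<open>B\<^sub>0\<close> be a single marker and
  \<open>B\<^sub>n\<^sub>+\<^sub>1 = B\<^sub>n R\<^sub>n B\<^sub>n\<close>, where the run \<open>R\<^sub>n\<close> of spacers \<open>0, 1, \<dots>, p - 1, 0, 1, \<dots>\<close>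
  has length at least \<open>n\<close> and is chosen such that the two copies of \<open>B\<^sub>n\<close> are \<open>1\<close> modulo \<open>n!\<close> apart.
  In the limit word, the marker at position \<open>u\<close> is coloured by \<open>i + u\<close> modulo \<open>q\<close>; the orbit
  closures \<open>X\<^sub>i\<close> (\<open>i\<close> modulo \<open>q\<close>) satisfy \<open>\<sigma> X\<^sub>i = X\<^sub>i\<^sub>+\<^sub>1\<close> and pairwise meet in the \<open>p\<close>-cycle \<open>V\<close> of the
  words without markers. Let \<open>C\<close> be closed with \<open>\<sigma>\<^sup>k C = C\<close>. If \<open>C \<subseteq> V\<close>, then \<open>\<sigma>\<^sup>p C = C\<close>.
  Otherwise \<open>C\<close> contains a word of some phase \<open>i\<close> with a marker; since the offsets are \<open>1\<close> modulo
  \<open>k q\<close> from some level on, near that marker every finite word of \<open>X\<^sub>i\<close> occurs at a multiple of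
  \<open>k q\<close>, so \<open>X\<^sub>i \<subseteq> C\<close>. Hence \<open>C\<close> is a union of sets \<open>X\<^sub>i\<close>, all of which contain \<open>V\<close>, and
  \<open>\<sigma>\<^sup>q C = C\<close>. This nesting is what prevents a cycle of \<open>V\<close> and one of the \<open>X\<^sub>i\<close> from combining to
  a least common multiple.\<close>

section \<open>Topology of sequence spaces\<close>

lemma tendsto_prefixI:
  fixes x :: "nat \<Rightarrow> nat"
  assumes "\<And>n u. u < n \<Longrightarrow> f n u = x u"
  shows "f \<longlonglongrightarrow> x"
proof -
  have "(\<lambda>n. f n u) \<longlonglongrightarrow> x u" for u
    by (rule tendsto_eventually) (auto simp: eventually_sequentially intro!: exI[of _ "Suc u"] assms)
  then show ?thesis
    using limitin_componentwise[of "\<lambda>_. euclidean" UNIV f x sequentially]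
    by (simp add: euclidean_product_topology)
qed

lemma closed_imp_prefix_closed:
  fixes x :: "nat \<Rightarrow> nat"
  assumes "closed S" "\<And>n. \<exists>y\<in>S. \<forall>u<n. y u = x u"
  shows "x \<in> S"
proof -
  obtain f where f: "\<And>n. f n \<in> S" "\<And>n u. u < n \<Longrightarrow> f n u = x u"
    using assms(2) by metis
  then show ?thesis
    using closed_sequentially[OF assms(1)] tendsto_prefixI by blast
qed

text \<open>Sequences suffice here: as letters are discrete, a convergent sequence of words
  eventually agrees with its limit on any finite prefix.\<close>

lemma prefix_closed_imp_closed:
  fixes S :: "(nat \<Rightarrow> nat) set"
  assumes "\<And>x. (\<And>n. \<exists>y\<in>S. \<forall>u<n. y u = x u) \<Longrightarrow> x \<in> S"
  shows "closed S"
  unfolding closed_sequential_limits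
proof (intro allI impI, elim conjE, rule assms)
  fix f x n assume f: "\<forall>k. f k \<in> S" "f \<longlonglongrightarrow> x"
  have "eventually (\<lambda>k. f k u = x u) sequentially" for u
  proof -
    have "(\<lambda>k. f k u) \<longlonglongrightarrow> x u"
      by (rule continuous_on_tendsto_compose[OF continuous_on_product_coordinates f(2)]) auto
    then show ?thesis
      by (simp add: nhds_discrete filterlim_principal)
  qed
  then have "eventually (\<lambda>k. \<forall>u\<in>{..<n}. f k u = x u) sequentially"
    by (intro eventually_ball_finite) auto
  then obtain k where "\<forall>u\<in>{..<n}. f k u = x u"
    using eventually_happens'[OF sequentially_bot] by blast
  then show "\<exists>y\<in>S. \<forall>u<n. y u = x u"
    using f(1) by blast
qed

definition shift :: "(nat \<Rightarrow> 'a) \<Rightarrow> nat \<Rightarrow> 'a" where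
  "shift x n = x (Suc n)"

lemma shift_funpow: "(shift ^^ k) x n = x (k + n)"
  by (induction k arbitrary: n) (auto simp: shift_def)

lemma continuous_on_shift: "continuous_on S (shift :: (nat \<Rightarrow> nat) \<Rightarrow> nat \<Rightarrow> nat)"
  unfolding shift_def[abs_def]
  by (intro continuous_on_coordinatewise_then_product continuous_on_subset[OF continuous_on_product_coordinates]) auto

lemma compact_bounded_sequences: "compact {x :: nat \<Rightarrow> nat. \<forall>n. x n < b}"
proof -
  have "compactin (product_topology (\<lambda>_. euclidean) UNIV) (PiE (UNIV::nat set) (\<lambda>_. {..<b}))"
    by (simp add: compactin_PiE finite_imp_compact)
  then show ?thesis
    by (simp add: euclidean_product_topology PiE_UNIV_domain Pi_def)
qed

text \<open>Base \<open>b + 1\<close> while the digits are below \<open>b\<close>: the missing top digit makes the expansion unique.\<close>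

definition digit_value :: "nat \<Rightarrow> (nat \<Rightarrow> nat) \<Rightarrow> real" where
  "digit_value b x = (\<Sum>n. real (x n) * (1 / (real b + 1)) ^ Suc n)"

text \<open>The value is strictly below 1, so no tail of an expansion can make up for a difference
  in the digit before it.\<close>

lemma sums_max_digits:
  assumes "b \<ge> 1" shows "(\<lambda>n. (real b - 1) * (1 / (real b + 1)) ^ Suc n) sums ((real b - 1) / b)"
proof -
  have "(\<lambda>n. (real b - 1) * (1 / (real b + 1)) * (1 / (real b + 1)) ^ n) sums
      ((real b - 1) * (1 / (real b + 1)) * (1 / (1 - 1 / (real b + 1))))"
    using assms by (intro sums_mult geometric_sums) simp
  moreover have "(real b - 1) * (1 / (real b + 1)) * (1 / (1 - 1 / (real b + 1))) = (real b - 1) / b"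
    using assms by (simp add: divide_simps)
  ultimately show ?thesis by (simp only: power_Suc mult.assoc[symmetric])
qed

lemma digit_le_max_digit:
  "a < b \<Longrightarrow> real a * (1 / (real b + 1)) ^ Suc n \<le> (real b - 1) * (1 / (real b + 1)) ^ Suc n"
  by (intro mult_right_mono) auto

context
  fixes b :: nat and x :: "nat \<Rightarrow> nat"
  assumes x: "\<And>n. x n < b"
begin

lemma digit_summable: "summable (\<lambda>n. real (x n) * (1 / (real b + 1)) ^ Suc n)"
proof (rule summable_comparison_test')
  show "summable (\<lambda>n. (real b - 1) * (1 / (real b + 1)) ^ Suc n)"
    using sums_max_digits[of b] x[of 0] by (auto simp: sums_iff)
  show "norm (real (x n) * (1 / (real b + 1)) ^ Suc n) \<le> (real b - 1) * (1 / (real b + 1)) ^ Suc n" for n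
    using digit_le_max_digit[OF x] by (simp add: abs_mult)
qed

lemma digit_value_nonneg: "0 \<le> digit_value b x"
  unfolding digit_value_def by (rule suminf_nonneg[OF digit_summable]) simp

lemma digit_value_less_1: "digit_value b x < 1"
proof -
  have "digit_value b x \<le> (real b - 1) / b"
    unfolding digit_value_def
    by (rule sums_le[OF digit_le_max_digit[OF x] summable_sums[OF digit_summable] sums_max_digits])
      (use x[of 0] in simp)
  also have "\<dots> < 1"
    using x[of 0] by simp
  finally show ?thesis .
qed

end

lemma digit_value_shift:
  assumes "\<And>n. x n < b"
  shows "digit_value b x * (real b + 1) = x 0 + digit_value b (shift x)"
proof -
  have "digit_value b x = (\<Sum>n. real (x (Suc n)) * (1 / (real b + 1)) ^ Suc (Suc n)) + real (x 0) / (real b + 1)"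
    unfolding digit_value_def by (subst suminf_split_head[OF digit_summable[OF assms]]) simp
  also have "(\<Sum>n. real (x (Suc n)) * (1 / (real b + 1)) ^ Suc (Suc n)) =
      (\<Sum>n. real (shift x n) * (1 / (real b + 1)) ^ Suc n * (1 / (real b + 1)))"
    by (simp only: power_Suc2 shift_def mult.assoc)
  also have "\<dots> = digit_value b (shift x) * (1 / (real b + 1))"
    unfolding digit_value_def
    by (rule suminf_mult2[symmetric, OF digit_summable]) (simp add: shift_def assms)
  finally show ?thesis
    by (simp add: add_divide_distrib[symmetric])
qed

text \<open>Tails have values at least 0 and below 1, so in \<open>digit_value_shift\<close> the
  first digit is an integer part; the same applies to every tail in turn.\<close>

lemma inj_on_digit_value: "inj_on (digit_value b) {x. \<forall>n. x n < b}"
proof (rule inj_onI, rule ext)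
  have *: "x 0 = y 0 \<and> digit_value b (shift x) = digit_value b (shift y)"
    if xy: "\<And>n. x n < b" "\<And>n. y n < b" "digit_value b x = digit_value b y" for x y
  proof -
    have "x 0 + digit_value b (shift x) = y 0 + digit_value b (shift y)"
      using xy by (metis digit_value_shift)
    moreover have "0 \<le> digit_value b (shift x)" "digit_value b (shift x) < 1"
      "0 \<le> digit_value b (shift y)" "digit_value b (shift y) < 1"
      using xy by (auto intro!: digit_value_nonneg digit_value_less_1 simp: shift_def)
    ultimately have "x 0 = y 0" by linarith
    with \<open>x 0 + digit_value b (shift x) = y 0 + digit_value b (shift y)\<close> show ?thesis by simp
  qed
  fix x y n
  assume xy: "x \<in> {x. \<forall>n. x n < b}" "y \<in> {x. \<forall>n. x n < b}" "digit_value b x = digit_value b y"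
  then show "x n = y n"
  proof (induction n arbitrary: x y)
    case 0
    then show ?case using * by simp
  next
    case (Suc n)
    then have "digit_value b (shift x) = digit_value b (shift y)"
      using * by simp
    moreover have "\<forall>n. shift x n < b" "\<forall>n. shift y n < b"
      using Suc.prems by (auto simp: shift_def)
    ultimately have "shift x n = shift y n"
      by (intro Suc.IH) auto
    then show ?case by (simp add: shift_def)
  qed
qed

lemma continuous_on_digit_value: "continuous_on {x. \<forall>n. x n < b} (digit_value b)"
proof (cases "b = 0")
  case False
  have "uniform_limit {x. \<forall>n. x n < b} (\<lambda>N x. \<Sum>n<N. real (x n) * (1 / (real b + 1)) ^ Suc n)
     (\<lambda>x. \<Sum>n. real (x n) * (1 / (real b + 1)) ^ Suc n) sequentially"
  proof (rule Weierstrass_m_test)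
    show "summable (\<lambda>n. (real b - 1) * (1 / (real b + 1)) ^ Suc n)"
      using sums_max_digits[of b] False by (auto simp: sums_iff)
    show "norm (real (x n) * (1 / (real b + 1)) ^ Suc n) \<le> (real b - 1) * (1 / (real b + 1)) ^ Suc n"
      if "x \<in> {x. \<forall>n. x n < b}" for n x
      using digit_le_max_digit[of "x n"] that by (simp add: abs_mult)
  qed
  moreover have "continuous_on S (\<lambda>x. real (x n))" for S :: "(nat \<Rightarrow> nat) set" and n
    by (rule continuous_on_compose2[of UNIV real, OF _
      continuous_on_subset[OF continuous_on_product_coordinates]]) (auto simp: continuous_on_open_invariant)
  then have "\<forall>\<^sub>F N in sequentially. continuous_on {x. \<forall>n. x n < b}
      (\<lambda>x. \<Sum>n<N. real (x n) * (1 / (real b + 1)) ^ Suc n)"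
    by (intro always_eventually allI continuous_on_sum continuous_on_mult continuous_on_const) auto
  ultimately show ?thesis
    unfolding digit_value_def[abs_def] by (intro uniform_limit_theorem) auto
qed simp

section \<open>Periods of closed sets\<close>

lemma induced_map_funpow: "(induced_map g ^^ k) C = (g ^^ k) ` C"
  by (induction k) (auto simp: induced_map_def image_comp)

text \<open>A version of \<open>Per_induced\<close> for topological spaces: \<^typ>\<open>nat \<Rightarrow> nat\<close> carries no library metric.\<close>

definition closed_set_periods :: "'a::topological_space set \<Rightarrow> ('a \<Rightarrow> 'a) \<Rightarrow> nat set" where
  "closed_set_periods X g = {k. k \<ge> 1 \<and> (\<exists>C. C \<noteq> {} \<and> C \<subseteq> X \<and> closed C \<and> (g ^^ k) ` C = C \<and>
     (\<forall>j. 1 \<le> j \<and> j < k \<longrightarrow> (g ^^ j) ` C \<noteq> C))}"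

lemma closed_set_periodsI:
  assumes "k \<ge> 1" "C \<noteq> {}" "C \<subseteq> X" "closed C" "(g ^^ k) ` C = C"
    and "\<And>j. 1 \<le> j \<Longrightarrow> j < k \<Longrightarrow> (g ^^ j) ` C \<noteq> C"
  shows "k \<in> closed_set_periods X g"
  unfolding closed_set_periods_def mem_Collect_eq
  by (intro conjI exI[of _ C] allI impI assms) simp_all

lemma Per_induced_eq_closed_set_periods: "Per_induced X g = closed_set_periods X g"
  by (auto simp: Per_induced_def closed_set_periods_def hyperspace_def induced_map_funpow)

text \<open>The image of a witness \<open>C\<close> under \<open>f\<close> has the same least
  period. The reverse inclusion comes from the inverse homeomorphism.\<close>

lemma closed_set_periods_homeomorphism:
  assumes h: "homeomorphism X Z f f'" and "closed Z" and gX: "g ` X \<subseteq> X"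
    and conj: "\<And>x. x \<in> X \<Longrightarrow> g' (f x) = f (g x)"
  shows "closed_set_periods X g \<subseteq> closed_set_periods Z g'"
proof
  have f: "\<And>x. x \<in> X \<Longrightarrow> f' (f x) = x" "f ` X = Z"
    using h by (auto simp: homeomorphism_def)
  have iter: "(g' ^^ j) ` f ` C = f ` (g ^^ j) ` C" if "C \<subseteq> X" for C j
  proof -
    have X: "(g ^^ j) x \<in> X" if "x \<in> X" for x j
      using gX that by (induction j) auto
    have "(g' ^^ j) (f x) = f ((g ^^ j) x)" if "x \<in> X" for x
      by (induction j) (use X conj that in auto)
    then show ?thesis using that unfolding image_image by (intro image_cong) auto
  qed
  fix k assume "k \<in> closed_set_periods X g"
  then obtain C where k: "k \<ge> 1" and C: "C \<noteq> {}" "C \<subseteq> X" "closed C" "(g ^^ k) ` C = C"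
    "\<forall>j. 1 \<le> j \<and> j < k \<longrightarrow> (g ^^ j) ` C \<noteq> C"
    unfolding closed_set_periods_def mem_Collect_eq by (elim conjE exE)
  have inj: "(g ^^ j) ` C = C" if "f ` (g ^^ j) ` C = f ` C" for j
  proof -
    have "(g ^^ j) x \<in> X" if "x \<in> X" for x
      using gX that by (induction j) auto
    then have "(g ^^ j) ` C \<subseteq> X" using C(2) by blast
    moreover have "inj_on f X" using f by (metis inj_onI)
    ultimately show ?thesis
      using inj_on_image_eq_iff[of f X "(g ^^ j) ` C" C] that C(2) by simp
  qed
  \<comment> \<open>As a preimage under \<open>f'\<close>, which is continuous on the closed set
    \<open>Z\<close>, the image is closed.\<close>
  have "f ` C = Z \<inter> f' -` C"
  proof (intro subset_antisym subsetI)
    fix z assume "z \<in> Z \<inter> f' -` C"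
    then show "z \<in> f ` C" using h by (intro image_eqI[of z f "f' z"]) (auto simp: homeomorphism_def)
  qed (use f C(2) in auto)
  then have "closed (f ` C)"
    using h C(3) \<open>closed Z\<close> by (simp add: homeomorphism_def continuous_closed_preimage)
  moreover have "f ` C \<noteq> {}" "f ` C \<subseteq> Z" "(g' ^^ k) ` f ` C = f ` C"
    using C(1,2,4) iter[OF C(2)] f(2) by auto
  moreover have "(g' ^^ j) ` f ` C \<noteq> f ` C" if "1 \<le> j" "j < k" for j
    using C(5) iter[OF C(2)] inj[of j] that by auto
  ultimately show "k \<in> closed_set_periods Z g'"
    unfolding closed_set_periods_def mem_Collect_eq using k by (intro conjI exI[of _ "f ` C"]) auto
qed

lemma cantor_set_homeomorphism:
  fixes X :: "'a::first_countable_topology set" and Z :: "'b::metric_space set"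
  assumes h: "homeomorphism X Z f f'"
    and X: "X \<noteq> {}" "compact X" "\<And>x. x \<in> X \<Longrightarrow> x islimpt X"
      "\<And>x. x \<in> X \<Longrightarrow> connected_component_set X x = {x}"
  shows "cantor_set Z"
  unfolding cantor_set_def
proof (intro conjI ballI)
  have f: "\<And>x. x \<in> X \<Longrightarrow> f' (f x) = x" "\<And>z. z \<in> Z \<Longrightarrow> f (f' z) = z" "f ` X = Z" "f' ` Z = X"
      "continuous_on X f"
    using h by (auto simp: homeomorphism_def)
  show "Z \<noteq> {}" "compact Z"
    using X f by (auto simp: compact_continuous_image)
  fix z assume z: "z \<in> Z"
  then have "f' z \<in> X" using f by blast
  with X(3) have "f' z islimpt X" by blast
  then obtain a where a: "\<forall>n. a n \<in> X - {f' z}" "a \<longlonglongrightarrow> f' z"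
    unfolding islimpt_sequential by blast
  have "eventually (\<lambda>n. a n \<in> X) sequentially"
    using a(1) by (intro always_eventually) blast
  then have "(\<lambda>n. f (a n)) \<longlonglongrightarrow> f (f' z)"
    by (rule continuous_on_tendsto_compose[OF f(5) a(2) \<open>f' z \<in> X\<close>])
  moreover have "f (a n) \<in> Z - {z}" for n
    using a(1) f(1-3) by (metis DiffD1 DiffD2 DiffI imageI singleton_iff)
  ultimately show "z islimpt Z"
    unfolding islimpt_sequential using f(2)[OF z] by (intro exI[of _ "\<lambda>n. f (a n)"]) simp
  have "w = z" if "connected_component Z z w" for w
  proof -
    have "connected_component X (f' z) (f' w)"
      using h that by (meson connected_component_homeomorphismI homeomorphism_sym)
    then have "f' w = f' z"
      using X(4) \<open>f' z \<in> X\<close> by auto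
    then show ?thesis
      using z that f by (metis connected_component_in)
  qed
  then show "connected_component_set Z z = {z}"
    using z by auto
qed

lemma closed_symbolic_compact:
  fixes X :: "(nat \<Rightarrow> nat) set"
  assumes "closed X" "X \<subseteq> {x. \<forall>n. x n < b}" shows "compact X"
  using assms compact_bounded_sequences compact_Int_closed by (metis inf.absorb2)

text \<open>A coordinate takes values in a discrete space, hence is constant on every connected
  set.\<close>

lemma symbolic_component:
  fixes X :: "(nat \<Rightarrow> nat) set"
  assumes "x \<in> X" shows "connected_component_set X x = {x}"
proof -
  have "y = x" if y: "connected_component X x y" for y
  proof
    fix n
    obtain T where T: "connected T" "x \<in> T" "y \<in> T"
      using y by (auto simp: connected_component_def)
    have "connected ((\<lambda>z. z n) ` T)"
      by (intro connected_continuous_image T continuous_on_subset[OF continuous_on_product_coordinates]) auto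
    then show "y n = x n"
      using connectedD[of "(\<lambda>z. z n) ` T" "{x n}" "- {x n}"] T open_discrete by fastforce
  qed
  then show ?thesis using assms by auto
qed

text \<open>\<open>digit_value\<close> embeds the compact set \<open>X\<close> in the reals, and the
  shift is carried over by conjugation. The hypothesis \<open>perfect\<close> expresses by prefixes
  that no point is isolated.\<close>

lemma symbolic_system_realization:
  fixes X :: "(nat \<Rightarrow> nat) set"
  assumes X: "X \<noteq> {}" "closed X" "X \<subseteq> {x. \<forall>n. x n < b}" and shift: "shift ` X = X"
    and perfect: "\<And>x n. x \<in> X \<Longrightarrow> \<exists>y\<in>X. y \<noteq> x \<and> (\<forall>u<n. y u = x u)"
  shows "\<exists>(Z :: real set) g. cantor_set Z \<and> continuous_on Z g \<and> g ` Z = Z \<and>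
           Per_induced Z g = closed_set_periods X shift"
proof -
  have comp: "compact X"
    using X closed_symbolic_compact by blast
  let ?f = "digit_value b" let ?Z = "?f ` X"
  obtain f' where h: "homeomorphism X ?Z ?f f'"
    using homeomorphism_compact[OF comp, of ?f] X(3) continuous_on_digit_value
      inj_on_digit_value by (metis continuous_on_subset inj_on_subset)
  let ?g = "?f \<circ> shift \<circ> f'"
  have f': "f' ` ?Z = X" "continuous_on ?Z f'" "\<And>x. x \<in> X \<Longrightarrow> f' (?f x) = x" "continuous_on X ?f"
    using h by (auto simp: homeomorphism_def)
  have "x islimpt X" if x: "x \<in> X" for x
  proof -
    obtain a where "\<And>n. a n \<in> X" "\<And>n. a n \<noteq> x" "\<And>n u. u < n \<Longrightarrow> a n u = x u"
      using perfect[OF x] by metis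
    then show ?thesis
      unfolding islimpt_sequential using tendsto_prefixI[of a x] by blast
  qed
  then have Z: "cantor_set ?Z"
    using cantor_set_homeomorphism[OF h X(1) comp] symbolic_component by blast
  have cont: "continuous_on ?Z ?g"
    using f' shift by (intro continuous_on_compose continuous_on_shift) auto
  have gZ: "?g ` ?Z = ?Z"
    using f'(1) shift by (metis image_comp)
  have "closed_set_periods ?Z ?g \<subseteq> closed_set_periods X shift"
  proof (rule closed_set_periods_homeomorphism[OF homeomorphism_symD[OF h] X(2)])
    show "shift (f' z) = f' (?g z)" if "z \<in> ?Z" for z
    proof -
      have "shift (f' z) \<in> X" using f'(1) shift that by blast
      then show ?thesis using f'(3) by simp
    qed
  qed (simp only: gZ order_refl)
  moreover have "closed_set_periods X shift \<subseteq> closed_set_periods ?Z ?g"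
    using Z shift f' by (intro closed_set_periods_homeomorphism[OF h])
      (auto simp: cantor_set_def compact_imp_closed)
  ultimately show ?thesis
    using Z cont gZ Per_induced_eq_closed_set_periods by blast
qed

section \<open>Arithmetic of periods\<close>

lemma funpow_image_mult:
  assumes "(g ^^ k) ` C = C" shows "(g ^^ (k * j)) ` C = C"
proof (induction j)
  case (Suc j)
  have "(g ^^ (k * Suc j)) ` C = (g ^^ k) ` (g ^^ (k * j)) ` C"
    by (simp add: funpow_add image_comp)
  then show ?case using Suc assms by simp
qed simp

lemma mod_add_right_cancel:
  fixes a b m q :: nat
  assumes "(a + m) mod q = (b + m) mod q" shows "a mod q = b mod q"
proof -
  have "int q dvd int (a + m) - int (b + m)"
    using assms by (metis mod_eq_dvd_iff zmod_int)
  then have "int a mod int q = int b mod int q"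
    by (simp add: mod_eq_dvd_iff)
  then show ?thesis
    by (metis of_nat_eq_iff zmod_int)
qed

lemma least_period_dvd:
  assumes k: "k \<ge> 1" "(g ^^ k) ` C = C" and least: "\<forall>j. 1 \<le> j \<and> j < k \<longrightarrow> (g ^^ j) ` C \<noteq> C"
    and m: "(g ^^ m) ` C = C"
  shows "k dvd m"
proof -
  have "(g ^^ (m mod k)) ` (g ^^ (k * (m div k))) ` C = (g ^^ m) ` C"
    by (metis funpow_add image_comp mod_mult_div_eq)
  \<comment> \<open>Division with remainder: the multiple of \<open>k\<close> preserves
    \<open>C\<close>, so the remainder does too and, being below \<open>k\<close>, must be
    0.\<close>
  then have "(g ^^ (m mod k)) ` C = C"
    using m funpow_image_mult[OF k(2)] by simp
  then have "m mod k = 0"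
    using least k(1) by (metis One_nat_def Suc_leI less_eq_Suc_le mod_less_divisor neq0_conv)
  then show ?thesis by auto
qed

section \<open>The limit word\<close>

locale spaced_blocks =
  fixes p q :: nat
  assumes p_pos: "p \<ge> 1" and q_pos: "q \<ge> 1"
begin

text \<open>The letter \<open>p\<close> is the marker and the letters below \<open>p\<close> are the
  spacers; colours enter only in \<open>letter\<close>. The run has length
  \<open>offset n - height n\<close>, so the second copy of \<open>block n\<close> starts at
  \<open>offset n\<close>.\<close>

fun block :: "nat \<Rightarrow> nat list" where
  "block 0 = [p]"
| "block (Suc n) = block n @
     map (\<lambda>i. i mod p) [0..<1 + fact n * (length (block n) + n) - length (block n)] @ block n"

definition height :: "nat \<Rightarrow> nat" where "height n = length (block n)"

definition offset :: "nat \<Rightarrow> nat" where "offset n = 1 + fact n * (height n + n)"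

text \<open>Since \<open>block t\<close> has more than \<open>t\<close> letters and each block is a
  prefix of the later ones, the diagonal reads off their limit.\<close>

definition limit_word :: "nat \<Rightarrow> nat" where "limit_word t = block t ! t"

lemma offset_gt: "height n + n < offset n"
proof -
  have "height n + n \<le> fact n * (height n + n)"
    by (metis fact_ge_1 mult_1 mult_le_mono1)
  then show ?thesis
    unfolding offset_def by linarith
qed

lemma height_Suc: "height (Suc n) = offset n + height n"
  using offset_gt[of n] by (simp add: height_def offset_def)

lemma height_gt: "n < height n"
proof (induction n)
  case 0
  show ?case by (simp add: height_def)
next
  case (Suc n)
  then show ?case using offset_gt[of n] by (simp add: height_Suc)
qed

lemma height_mono: "m \<le> n \<Longrightarrow> height m \<le> height n"
  by (rule lift_Suc_mono_le) (auto simp: height_Suc)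

lemma block_prefix: "m \<le> n \<Longrightarrow> u < height m \<Longrightarrow> block n ! u = block m ! u"
proof (induction n)
  case (Suc n)
  show ?case
  proof (cases "m = Suc n")
    case False
    with Suc have "m \<le> n" by simp
    with Suc height_mono[of m n] have "u < height n" by simp
    then have "block (Suc n) ! u = block n ! u"
      by (simp add: nth_append height_def)
    with Suc \<open>m \<le> n\<close> show ?thesis by simp
  qed simp
qed (use height_def in simp)

lemma limit_word_block: "u < height n \<Longrightarrow> limit_word u = block n ! u"
  using block_prefix[of u n u] block_prefix[of n u u] height_gt[of u]
  unfolding limit_word_def by (metis nle_le)

lemma limit_word_0: "limit_word 0 = p"
  by (simp add: limit_word_def)

lemma limit_word_offset_add:
  assumes "u < height n" shows "limit_word (offset n + u) = limit_word u"
proof -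
  have "limit_word (offset n + u) = block (Suc n) ! (offset n + u)"
    using assms by (intro limit_word_block) (simp add: height_Suc)
  also have "\<dots> = block n ! u"
    using offset_gt[of n] assms by (auto simp: nth_append height_def offset_def)
  finally show ?thesis using assms limit_word_block by simp
qed

lemma limit_word_run:
  assumes "height n \<le> u" "u < offset n" shows "limit_word u = (u - height n) mod p"
proof -
  have "limit_word u = block (Suc n) ! u"
    using assms by (intro limit_word_block) (simp add: height_Suc)
  also have "\<dots> = (u - height n) mod p"
    using assms by (auto simp: nth_append height_def offset_def)
  finally show ?thesis .
qed

lemma limit_word_run_less: "height n \<le> u \<Longrightarrow> u < offset n \<Longrightarrow> limit_word u < p"
  using limit_word_run p_pos by simp

lemma limit_word_offset: "limit_word (offset n) = p"
  using limit_word_offset_add[of 0 n] height_gt[of n] limit_word_0 by simp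

lemma limit_word_last: "limit_word (height n - 1) = p"
proof (induction n)
  case 0
  show ?case using limit_word_0 by (simp add: height_def)
next
  case (Suc n)
  then show ?case
    using limit_word_offset_add[of "height n - 1" n] height_gt[of n] by (simp add: height_Suc)
qed

lemma block_position_cases:
  assumes "u < height (Suc n)"
  obtains "u < height n" | "height n \<le> u" "u < offset n" | v where "u = offset n + v" "v < height n"
proof -
  consider "u < height n" | "height n \<le> u" "u < offset n" | "offset n \<le> u" by linarith
  then show ?thesis
  proof cases
    case 3
    then show ?thesis using that(3)[of "u - offset n"] assms by (simp add: height_Suc)
  qed (use that in auto)
qed

lemma limit_word_le: "limit_word u \<le> p"
proof -
  have "u < height n \<Longrightarrow> limit_word u \<le> p" for n
  proof (induction n arbitrary: u)
    case 0
    then show ?case using limit_word_0 by (simp add: height_def)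
  next
    case (Suc n)
    from Suc.prems show ?case
      by (cases rule: block_position_cases)
        (use Suc.IH limit_word_offset_add less_imp_le[OF limit_word_run_less] in auto)
  qed
  then show ?thesis using height_gt by blast
qed

text \<open>Blocks begin and end with a marker, so two adjacent spacers lie in one run, where the
  letters count modulo \<open>p\<close>.\<close>

lemma limit_word_Suc:
  assumes "limit_word u < p" "limit_word (Suc u) < p"
  shows "limit_word (Suc u) = Suc (limit_word u) mod p"
proof -
  have "Suc u < height n \<Longrightarrow> limit_word u < p \<Longrightarrow> limit_word (Suc u) < p
      \<Longrightarrow> limit_word (Suc u) = Suc (limit_word u) mod p" for n
  proof (induction n arbitrary: u)
    case 0
    then show ?case by (simp add: height_def)
  next
    case (Suc n)
    from Suc.prems(1) have "u < height (Suc n)" by simp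
    then show ?case
    proof (cases rule: block_position_cases)
      case 1
      then have "Suc u < height n"
        using limit_word_last[of n] Suc.prems by (metis Suc_lessI diff_Suc_1 less_irrefl)
      then show ?thesis using Suc by blast
    next
      case 2
      then have "Suc u < offset n"
        using limit_word_offset[of n] Suc.prems by (cases "Suc u = offset n") auto
      then show ?thesis using 2 limit_word_run[of n] by (simp add: Suc_diff_le mod_Suc_eq)
    next
      case (3 v)
      then have "Suc v < height n"
        using Suc.prems(1) by (simp add: height_Suc)
      then show ?thesis
        using Suc limit_word_offset_add[of v n] limit_word_offset_add[of "Suc v" n] 3 by auto
    qed
  qed
  then show ?thesis using assms height_gt by blast
qed

text \<open>Runs contain no marker, so a marker in a block lies in one of the two copies of the
  preceding block; descend until level \<open>n\<close>.\<close>

lemma marker_in_block_copy: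
  assumes "limit_word m = p"
  shows "\<exists>t \<le> m. m < t + height n \<and> (\<forall>u < height n. limit_word (t + u) = limit_word u)"
proof -
  \<comment> \<open>That the copy ends within \<open>block (n + k)\<close> allows it to be
    translated by the offset of that level.\<close>
  have "m < height (n + k) \<Longrightarrow> limit_word m = p \<Longrightarrow> \<exists>t \<le> m. m < t + height n \<and>
      t + height n \<le> height (n + k) \<and> (\<forall>u < height n. limit_word (t + u) = limit_word u)" for k
  proof (induction k arbitrary: m)
    case 0
    then show ?case by (intro exI[of _ 0]) auto
  next
    case (Suc k)
    from Suc.prems have "m < height (Suc (n + k))" by simp
    then show ?case
    proof (cases rule: block_position_cases)
      case 1
      then show ?thesis using Suc.IH[OF 1 Suc.prems(2)] by (auto simp: height_Suc)
    next
      case 2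
      then show ?thesis using limit_word_run_less[OF 2] Suc.prems by simp
    next
      case (3 v)
      then have "limit_word v = p" using limit_word_offset_add Suc.prems by simp
      then obtain t where t: "t \<le> v" "v < t + height n" "t + height n \<le> height (n + k)"
        "\<forall>u < height n. limit_word (t + u) = limit_word u"
        using Suc.IH 3 by blast
      moreover have "limit_word (offset (n + k) + t + u) = limit_word u" if "u < height n" for u
        using limit_word_offset_add[of "t + u" "n + k"] t that by (simp add: add.assoc)
      ultimately show ?thesis
        using 3 by (intro exI[of _ "offset (n + k) + t"]) (auto simp: height_Suc)
    qed
  qed
  moreover have "m < height (n + m)"
    using height_gt[of m] height_mono[of m "n + m"] by simp
  ultimately show ?thesis using assms by blast
qed

section \<open>Occurrences in prescribed residue classes\<close>

lemma offset_cong_1: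
  assumes "k \<ge> 1" "k \<le> n" shows "offset n mod k = 1 mod k"
proof -
  have "k dvd fact n * (height n + n)"
    using assms by (simp add: dvd_fact)
  then show ?thesis
    unfolding offset_def by (metis add.commute mod_add_self2 dvd_imp_mod_0 mod_add_right_eq add_0)
qed

text \<open>Passing to the second copy of a block moves an occurrence by an offset, which is 1
  modulo \<open>k\<close> from level \<open>k\<close> on; after \<open>k\<close> levels every
  residue is reached.\<close>

lemma block_copy_residues:
  assumes "k \<ge> 1"
  shows "\<exists>N. \<forall>r. \<exists>t. t mod k = r mod k \<and> t + n \<le> height N \<and>
           (\<forall>u < n. limit_word (t + u) = limit_word u)"
proof -
  \<comment> \<open>Level \<open>n\<close> makes the block long enough for the prefix, level
    \<open>k\<close> makes all further offsets 1 modulo \<open>k\<close>.\<close>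
  define m where "m = max n k"
  have m: "n \<le> height m" "k \<le> m"
    using height_gt[of m] by (auto simp: m_def)
  have *: "\<forall>i \<le> j. \<exists>t. t mod k = i mod k \<and> t + n \<le> height (m + j) \<and>
           (\<forall>u < n. limit_word (t + u) = limit_word u)" for j
  proof (induction j)
    case 0
    then show ?case using m by (auto intro!: exI[of _ 0])
  next
    case (Suc j)
    show ?case
    proof (intro allI impI)
      fix i assume "i \<le> Suc j"
      then consider "i \<le> j" | "i = Suc j" by linarith
      then show "\<exists>t. t mod k = i mod k \<and> t + n \<le> height (m + Suc j) \<and>
           (\<forall>u < n. limit_word (t + u) = limit_word u)"
      proof cases
        case 1
        with Suc.IH obtain t where "t mod k = i mod k" "t + n \<le> height (m + j)"
          "\<forall>u < n. limit_word (t + u) = limit_word u" by blast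
        then show ?thesis
          by (intro exI[of _ t]) (auto simp: height_Suc)
      next
        case 2
        from Suc.IH obtain t where t: "t mod k = j mod k" "t + n \<le> height (m + j)"
          "\<forall>u < n. limit_word (t + u) = limit_word u" by blast
        have "limit_word (offset (m + j) + t + u) = limit_word u" if "u < n" for u
          using limit_word_offset_add[of "t + u" "m + j"] t that by (simp add: add.assoc)
        moreover have "(offset (m + j) + t) mod k = i mod k"
          using offset_cong_1[of k "m + j"] t(1) 2 assms m
          by (metis mod_add_eq plus_1_eq_Suc trans_le_add1)
        ultimately show ?thesis
          using t by (intro exI[of _ "offset (m + j) + t"]) (auto simp: height_Suc)
      qed
    qed
  qed
  have "\<exists>t. t mod k = r mod k \<and> t + n \<le> height (m + k) \<and>
           (\<forall>u < n. limit_word (t + u) = limit_word u)" for r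
    using *[of k, rule_format, of "r mod k"] assms by (simp add: less_imp_le)
  then show ?thesis by blast
qed

text \<open>Every marker sits in a copy of one fixed block that holds the prefix at all residues, so
  \<open>N\<close> serves all markers. Sums replace differences to avoid truncated
  subtraction.\<close>

lemma prefix_near_marker:
  assumes "k \<ge> 1"
  shows "\<exists>N. \<forall>m r. limit_word m = p \<longrightarrow> (\<exists>t. m \<le> t + N \<and> t + n \<le> m + N \<and> t mod k = r mod k \<and>
           (\<forall>u < n. limit_word (t + u) = limit_word u))"
proof -
  obtain N where N: "\<And>r. \<exists>t. t mod k = r mod k \<and> t + n \<le> height N \<and>
           (\<forall>u < n. limit_word (t + u) = limit_word u)"
    using block_copy_residues[OF assms] by metis
  have "\<exists>t. m \<le> t + height N \<and> t + n \<le> m + height N \<and> t mod k = r mod k \<and>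
           (\<forall>u < n. limit_word (t + u) = limit_word u)" if marker: "limit_word m = p" for m r
  proof -
    obtain t where t: "t \<le> m" "m < t + height N"
        "\<forall>u < height N. limit_word (t + u) = limit_word u"
      using marker_in_block_copy[OF marker] by blast
    \<comment> \<open>Modulo \<open>k\<close> the required residue is \<open>r - t\<close>, with
      \<open>(k - 1) * t\<close> standing for \<open>- t\<close>.\<close>
    obtain t' where t': "t' mod k = (r + (k - 1) * t) mod k" "t' + n \<le> height N"
           "\<forall>u < n. limit_word (t' + u) = limit_word u"
      using N by blast
    have "(t + t') mod k = (t + (r + (k - 1) * t)) mod k"
      using t'(1) by (metis mod_add_right_eq)
    also have "t + (r + (k - 1) * t) = r + k * t"
      using assms by (cases k) auto
    finally have "(t + t') mod k = r mod k" by simp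
    moreover have "limit_word (t + t' + u) = limit_word u" if "u < n" for u
      using t t' that by (simp add: add.assoc)
    ultimately show ?thesis
      using t t' by (intro exI[of _ "t + t'"]) auto
  qed
  then show ?thesis by blast
qed

lemma limit_word_recurrent: "\<exists>N\<ge>1. \<forall>u < n. limit_word (N + u) = limit_word u"
  using limit_word_offset_add height_gt[of n] by (intro exI[of _ "offset n"]) (auto simp: offset_def)

lemma limit_word_not_eventually_periodic:
  assumes "e \<ge> 1"
  shows "\<exists>v\<ge>t. limit_word (v + e) = p \<and> limit_word v < p"
proof -
  \<comment> \<open>As \<open>n\<close> is at least \<open>e\<close>, the run before
    \<open>offset n\<close> is longer than \<open>e\<close>, so \<open>e\<close> places before that
    marker stands a spacer; as \<open>n\<close> is at least \<open>t\<close>, it lies beyond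
    \<open>t\<close>.\<close>
  define n where "n = max t e"
  have "height n \<le> offset n - e" "e \<le> offset n" "t \<le> offset n - e"
    using offset_gt[of n] height_gt[of n] by (auto simp: n_def)
  then show ?thesis
    using limit_word_run_less[of n "offset n - e"] limit_word_offset[of n] assms
    by (intro exI[of _ "offset n - e"]) auto
qed

section \<open>The subshift\<close>

text \<open>The colour depends on the position \<open>u\<close> in the window, not on the place
  \<open>t\<close> where the limit word is read. Hence \<open>i\<close> is the phase of the first
  letter of the window, and windows of equal phase are compared through \<open>limit_word\<close>
  alone.\<close>

definition letter :: "nat \<Rightarrow> nat \<Rightarrow> nat \<Rightarrow> nat" where
  "letter i t u = (if limit_word (t + u) < p then limit_word (t + u) else p + (i + u) mod q)"

definition phase_shift :: "nat \<Rightarrow> (nat \<Rightarrow> nat) set" where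
  "phase_shift i = {x. \<forall>n. \<exists>t. \<forall>u<n. x u = letter i t u}"

definition subshift :: "(nat \<Rightarrow> nat) set" where
  "subshift = (\<Union>i<q. phase_shift i)"

definition spacer :: "nat \<Rightarrow> nat \<Rightarrow> nat" where
  "spacer j u = (j + u) mod p"

lemma letter_marker: "p \<le> letter i t u \<longleftrightarrow> limit_word (t + u) = p"
  using limit_word_le[of "t + u"] by (auto simp: letter_def)

lemma letter_cong: "limit_word (t + u) = limit_word (t' + u') \<Longrightarrow> (i + u) mod q = (i' + u') mod q
    \<Longrightarrow> letter i t u = letter i' t' u'"
  by (simp add: letter_def)

lemma letter_less: "letter i t u < p + q"
  using q_pos by (auto simp: letter_def)

lemma letter_in_phase_shift: "letter i t \<in> phase_shift i"
  by (auto simp: phase_shift_def)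

lemma phase_shift_mod: "phase_shift (i mod q) = phase_shift i"
  by (simp add: phase_shift_def letter_def mod_add_left_eq)

lemma phase_shift_less:
  assumes "x \<in> phase_shift i" shows "x n < p + q"
proof -
  obtain t where "x n = letter i t n"
    using assms unfolding phase_shift_def by blast
  then show ?thesis by (simp add: letter_less)
qed

text \<open>This recovers the phase modulo \<open>q\<close> from a single marker.\<close>

lemma phase_shift_marker:
  assumes "x \<in> phase_shift i" "p \<le> x m" shows "x m = p + (i + m) mod q"
proof -
  obtain t where "x m = letter i t m"
    using assms(1) unfolding phase_shift_def by blast
  then show ?thesis using assms(2) by (auto simp: letter_def)
qed

lemma closed_phase_shift: "closed (phase_shift i)"
proof (rule prefix_closed_imp_closed)
  fix x assume x: "\<And>n. \<exists>y\<in>phase_shift i. \<forall>u<n. y u = x u"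
  have "\<exists>t. \<forall>u<n. x u = letter i t u" for n
  proof -
    obtain y where y: "y \<in> phase_shift i" "\<forall>u<n. y u = x u" using x by blast
    then obtain t where "\<forall>u<n. y u = letter i t u" unfolding phase_shift_def by blast
    then have "\<forall>u<n. x u = letter i t u" using y(2) by simp
    then show ?thesis ..
  qed
  then show "x \<in> phase_shift i" by (simp add: phase_shift_def)
qed

lemma spacer_in_phase_shift: "spacer j \<in> phase_shift i"
proof -
  \<comment> \<open>The run of level \<open>j + n\<close> has more than \<open>j + n\<close>
    letters, so at least \<open>n\<close> remain after skipping \<open>j\<close>.\<close>
  have "\<forall>u<n. spacer j u = letter i (height (j + n) + j) u" for n
  proof (intro allI impI)
    fix u assume "u < n"
    then have "height (j + n) + j + u < offset (j + n)"
      using offset_gt[of "j + n"] by simp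
    then show "spacer j u = letter i (height (j + n) + j) u"
      using limit_word_run[of "j + n" "height (j + n) + j + u"] p_pos
      by (simp add: letter_def spacer_def)
  qed
  then show ?thesis unfolding phase_shift_def by blast
qed

lemma spacer_characterization:
  assumes "x 0 < p" "\<And>u. x (Suc u) = Suc (x u) mod p" shows "x = spacer (x 0)"
proof
  show "x u = spacer (x 0) u" for u
    by (induction u) (use assms in \<open>auto simp: spacer_def mod_Suc_eq\<close>)
qed

lemma markerfree_spacer:
  assumes x: "x \<in> phase_shift i" and free: "\<And>m. x m < p" shows "x = spacer (x 0)"
proof (rule spacer_characterization)
  fix u
  have "\<exists>t. \<forall>v < Suc (Suc u). x v = letter i t v"
    using x by (simp add: phase_shift_def)
  then obtain t where t: "x u = letter i t u" "x (Suc u) = letter i t (Suc u)"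
    by auto
  moreover have "letter i t u < p" "letter i t (Suc u) < p"
    using t free by metis+
  ultimately show "x (Suc u) = Suc (x u) mod p"
    using limit_word_Suc[of "t + u"] by (auto simp: letter_def split: if_splits)
qed (use free in auto)

text \<open>Since \<open>t'\<close> exceeds \<open>t\<close>, the second occurrence has a letter
  before it and is a genuinely different place to read the word.\<close>

lemma letter_recurrent: "\<exists>t' > t. \<forall>u<n. limit_word (t' + u) = limit_word (t + u)"
proof -
  obtain N where "N \<ge> 1" "\<forall>u < t + n. limit_word (N + u) = limit_word u"
    using limit_word_recurrent by blast
  then show ?thesis
    by (intro exI[of _ "N + t"]) (simp add: add.assoc)
qed

text \<open>Moving the window by one raises the phase by one. Conversely, every prefix extends to
  the left, and as the alphabet is finite, one letter serves all prefixes.\<close>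

lemma shift_phase_shift: "shift ` phase_shift i = phase_shift (Suc i)"
proof
  show "shift ` phase_shift i \<subseteq> phase_shift (Suc i)"
  proof
    fix y assume "y \<in> shift ` phase_shift i"
    then obtain x where x: "x \<in> phase_shift i" and y: "y = shift x" by blast
    have "\<exists>t. \<forall>u<n. y u = letter (Suc i) t u" for n
    proof -
      obtain t where t: "\<forall>u < Suc n. x u = letter i t u"
        using x unfolding phase_shift_def by blast
      have "y u = letter (Suc i) (Suc t) u" if "u < n" for u
        using t that by (auto simp: y shift_def intro!: letter_cong)
      then show ?thesis by blast
    qed
    then show "y \<in> phase_shift (Suc i)" by (simp add: phase_shift_def)
  qed
  show "phase_shift (Suc i) \<subseteq> shift ` phase_shift i"
  proof
    fix x assume x: "x \<in> phase_shift (Suc i)"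
    have "\<exists>a. case_nat a x \<in> phase_shift i"
    proof (rule ccontr)
      assume "\<not> ?thesis"
      then have "\<forall>a. \<exists>n. \<forall>t. \<exists>u<n. case_nat a x u \<noteq> letter i t u"
        by (simp add: phase_shift_def)
      then obtain f where f: "\<And>a t. \<exists>u<f a. case_nat a x u \<noteq> letter i t u"
        by metis
      \<comment> \<open>A letter \<open>a\<close> that fails does so within length
        \<open>f a\<close>; the maximum covers all letters at once.\<close>
      define n where "n = Max (f ` {..<p + q})"
      obtain t where t: "\<forall>u<n. x u = letter (Suc i) t u"
        using x unfolding phase_shift_def by blast
      obtain t' where t': "t' > t" "\<forall>u<n. limit_word (t' + u) = limit_word (t + u)"
        using letter_recurrent by blast
      \<comment> \<open>As \<open>t' > 0\<close>, this letter precedes an occurrence of the prefix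
        and so cannot fail.\<close>
      define a where "a = letter i (t' - 1) 0"
      have "f a \<le> n"
        unfolding n_def by (intro Max_ge) (auto simp: a_def letter_less)
      obtain u where u: "u < f a" "case_nat a x u \<noteq> letter i (t' - 1) u"
        using f by blast
      then obtain v where v: "u = Suc v"
        by (cases u) (auto simp: a_def)
      then have "letter i (t' - 1) u = letter (Suc i) t v"
        using t' u(1) \<open>f a \<le> n\<close> by (auto intro!: letter_cong)
      then show False
        using t u v \<open>f a \<le> n\<close> by simp
    qed
    then obtain a where "case_nat a x \<in> phase_shift i" ..
    moreover have "shift (case_nat a x) = x"
      by (auto simp: shift_def)
    ultimately show "x \<in> shift ` phase_shift i"
      by (metis imageI)
  qed
qed

lemma shift_funpow_phase_shift: "(shift ^^ j) ` phase_shift i = phase_shift (i + j)"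
proof (induction j)
  case (Suc j)
  have "(shift ^^ Suc j) ` phase_shift i = shift ` (shift ^^ j) ` phase_shift i"
    by (simp add: image_comp)
  then show ?case using Suc by (simp add: shift_phase_shift)
qed simp

lemma shift_funpow_q_phase_shift: "(shift ^^ q) ` phase_shift i = phase_shift i"
  using shift_funpow_phase_shift[of q i] phase_shift_mod[of "i + q"] phase_shift_mod[of i]
  by simp

text \<open>The prefix occurs at two places, whose continuations differ because the limit word is
  not eventually periodic; at least one of the two differs from \<open>x\<close>.\<close>

lemma phase_shift_perfect:
  assumes "x \<in> phase_shift i" shows "\<exists>y\<in>phase_shift i. y \<noteq> x \<and> (\<forall>u<n. y u = x u)"
proof -
  obtain t where t: "\<forall>u<n. x u = letter i t u"
    using assms unfolding phase_shift_def by blast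
  obtain t' where t': "t' > t" "\<forall>u<n. limit_word (t' + u) = limit_word (t + u)"
    using letter_recurrent by blast
  obtain v where v: "v \<ge> t" "limit_word (v + (t' - t)) = p" "limit_word v < p"
    using limit_word_not_eventually_periodic[of "t' - t" t] t'(1) by force
  have "letter i t (v - t) < p" "p \<le> letter i t' (v - t)"
  proof -
    have "t + (v - t) = v" "t' + (v - t) = v + (t' - t)"
      using v(1) t'(1) by simp_all
    then show "letter i t (v - t) < p" "p \<le> letter i t' (v - t)"
      using v(2,3) by (simp_all add: letter_marker letter_def)
  qed
  then have "letter i t \<noteq> letter i t'" by auto
  moreover have "\<forall>u<n. letter i t' u = x u"
    using t t'(2) by (auto intro!: letter_cong)
  ultimately show ?thesis
    using t letter_in_phase_shift by metis
qed

lemma subshift_eq: "subshift = (\<Union>i. phase_shift i)"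
proof -
  have "phase_shift i \<subseteq> subshift" for i
    unfolding subshift_def using phase_shift_mod[of i] q_pos
      UN_upper[of "i mod q" "{..<q}" phase_shift] by simp
  then show ?thesis by (auto simp: subshift_def)
qed

lemma shift_subshift: "shift ` subshift = subshift"
proof -
  \<comment> \<open>The phase \<open>i + q - 1\<close> acts as predecessor of \<open>i\<close>, also
    for \<open>i = 0\<close>.\<close>
  have "phase_shift i \<subseteq> (\<Union>i. phase_shift (Suc i))" for i
    using phase_shift_mod[of "i + q"] phase_shift_mod[of i] q_pos
      UN_upper[of "i + q - 1" UNIV "\<lambda>i. phase_shift (Suc i)"] by simp
  then show ?thesis
    unfolding subshift_eq image_UN shift_phase_shift by blast
qed

text \<open>Preimages of a point with a marker push the marker far to the right; near it every finite
  word of its phase occurs at a position divisible by \<open>k\<close>.\<close>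

lemma marked_phase_subset:
  assumes "closed C" "C \<subseteq> subshift" and k: "k \<ge> 1" "(shift ^^ k) ` C = C"
    and x: "x \<in> C" "x \<in> phase_shift i" "p \<le> x m"
  shows "phase_shift i \<subseteq> C"
proof
  fix z assume z: "z \<in> phase_shift i"
  show "z \<in> C"
  proof (rule closed_imp_prefix_closed[OF \<open>closed C\<close>])
    fix n
    obtain t where t: "\<forall>u<n. z u = letter i t u"
      using z unfolding phase_shift_def by blast
    \<comment> \<open>Multiples of \<open>k\<close> preserve \<open>C\<close>, multiples of
      \<open>q\<close> preserve the phase.\<close>
    define K where "K = k * q"
    have K: "K \<ge> 1" "(shift ^^ (K * j)) ` C = C" for j
      using k q_pos funpow_image_mult[OF k(2), of "q * j"] by (auto simp: K_def mult.assoc)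
    obtain N where N: "\<And>m r. limit_word m = p \<Longrightarrow> \<exists>T. m \<le> T + N \<and> T + (t + n) \<le> m + N \<and>
        T mod K = r mod K \<and> (\<forall>u < t + n. limit_word (T + u) = limit_word u)"
      using prefix_near_marker[OF K(1), of "t + n"] by metis
    \<comment> \<open>The preimage has its marker at least \<open>N\<close> letters from the start,
      so the neighbourhood of radius \<open>N\<close> does not cross position 0.\<close>
    obtain x' where x': "x' \<in> C" "x = (shift ^^ (K * N)) x'"
      using K(2)[of N] x(1) by blast
    define m' where "m' = K * N + m"
    have xm: "x' m' = x m"
      by (simp add: x'(2) shift_funpow m'_def)
    obtain i' where i': "x' \<in> phase_shift i'"
      using x' assms(2) by (auto simp: subshift_def)
    obtain s where s: "\<forall>u < Suc (m' + N). x' u = letter i' s u"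
      using i' unfolding phase_shift_def by blast
    have "p + (i' + m') mod q = p + (i + m) mod q"
      using phase_shift_marker[OF i', of m'] phase_shift_marker[OF x(2,3)] x(3) xm by simp
    then have phase: "(i' + m') mod q = (i + m) mod q" by simp
    have "p \<le> letter i' s m'"
      using s x(3) xm by (metis le_add1 le_imp_less_Suc)
    then have "limit_word (s + m') = p"
      by (simp add: letter_marker)
    \<comment> \<open>The residue is that of \<open>s - t\<close>, which makes the position
      \<open>e\<close> of the word in \<open>x'\<close> a multiple of \<open>K\<close>.\<close>
    then obtain T where T: "s + m' \<le> T + N" "T + (t + n) \<le> s + m' + N"
        "T mod K = (s + (K - 1) * t) mod K" "\<forall>u < t + n. limit_word (T + u) = limit_word u"
      using N by blast
    have "N \<le> K * N" using K(1) by simp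
    then have "s \<le> T" using T(1) unfolding m'_def by linarith
    define e where "e = T - s + t"
    have "(e + s) mod K = (s + (K - 1) * t + t) mod K"
      using T(3) \<open>s \<le> T\<close> by (simp add: e_def mod_add_left_eq[symmetric, of T] mod_add_left_eq)
    also have "s + (K - 1) * t + t = s + K * t"
      using K(1) by (cases K) auto
    finally have "K dvd e"
      by (metis add.commute add_diff_cancel_right' le_add1 mod_eq_dvd_iff_nat mod_mult_self2)
    then have "e mod q = 0"
      using dvd_trans[of q K e] by (simp add: K_def)
    have "(shift ^^ e) x' \<in> C"
      using K(2) x'(1) \<open>K dvd e\<close> by (metis dvdE imageI)
    moreover have "(shift ^^ e) x' u = z u" if "u < n" for u
    proof -
      have "e + u < Suc (m' + N)"
        using T(2) \<open>s \<le> T\<close> that by (simp add: e_def)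
      then have "(shift ^^ e) x' u = letter i' s (e + u)"
        using s by (simp add: shift_funpow)
      also have "\<dots> = letter i t u"
      proof (rule letter_cong)
        have "s + (e + u) = T + (t + u)"
          using \<open>s \<le> T\<close> by (simp add: e_def)
        then show "limit_word (s + (e + u)) = limit_word (t + u)"
          using T(4) that by (metis add_less_cancel_left)
        \<comment> \<open>The marker was moved by a multiple of \<open>q\<close>, so its colour
          forces \<open>i'\<close> and \<open>i\<close> to agree modulo \<open>q\<close>.\<close>
        have "m' = m + q * (k * N)"
          by (simp add: m'_def K_def)
        then have "m' mod q = m mod q" by simp
        then have "(i' + m) mod q = (i + m) mod q"
          using phase by (metis mod_add_right_eq)
        then have "i' mod q = i mod q"
          by (rule mod_add_right_cancel)
        then have "(i' + u) mod q = (i + u) mod q"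
          by (metis mod_add_left_eq)
        then show "(i' + (e + u)) mod q = (i + u) mod q"
          using \<open>e mod q = 0\<close> mod_add_right_eq[of "i' + u" e q] by (simp add: add.commute add.left_commute)
      qed
      finally show ?thesis using t that by simp
    qed
    ultimately show "\<exists>y\<in>C. \<forall>u<n. y u = z u" by blast
  qed
qed

section \<open>Realising the divisors of \<open>p\<close> and of \<open>q\<close>\<close>

lemma shift_funpow_spacer: "(shift ^^ k) (spacer j) = spacer (j + k)"
  by (rule ext) (simp add: shift_funpow spacer_def add.assoc)

lemma spacer_mod: "spacer (j mod p) = spacer j"
  by (simp add: spacer_def mod_add_left_eq fun_eq_iff)

text \<open>The first letter and the pairs of neighbours determine a member; as
  \<open>m dvd p\<close>, divisibility by \<open>m\<close> survives reduction modulo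
  \<open>p\<close>.\<close>

lemma closed_spacers:
  assumes "m dvd p" shows "closed {spacer j | j. m dvd j}"
proof (rule prefix_closed_imp_closed)
  fix x :: "nat \<Rightarrow> nat" assume "\<And>n. \<exists>y\<in>{spacer j | j. m dvd j}. \<forall>u<n. y u = x u"
  have x: "\<exists>j. m dvd j \<and> (\<forall>u<n. x u = (j + u) mod p)" for n
  proof -
    obtain y where "y \<in> {spacer j | j. m dvd j}" "\<forall>u<n. y u = x u"
      using \<open>\<And>n. \<exists>y\<in>{spacer j | j. m dvd j}. \<forall>u<n. y u = x u\<close> by blast
    then show ?thesis by (auto simp: spacer_def)
  qed
  have "x = spacer (x 0)"
  proof (rule spacer_characterization)
    show "x 0 < p" using x[of 1] p_pos by auto
    show "x (Suc u) = Suc (x u) mod p" for u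
      using x[of "Suc (Suc u)"] by (auto simp: mod_Suc_eq)
  qed
  moreover have "m dvd x 0"
    using x[of 1] assms by (auto simp: dvd_mod)
  ultimately show "x \<in> {spacer j | j. m dvd j}" by blast
qed

lemma divisors_of_p_periods:
  assumes m: "m dvd p" "m \<ge> 1" shows "m \<in> closed_set_periods subshift shift"
proof -
  let ?C = "{spacer j | j. m dvd j}"
  show ?thesis
  proof (rule closed_set_periodsI[where C = ?C])
    show "?C \<subseteq> subshift"
      using spacer_in_phase_shift by (auto simp: subshift_eq)
    show "?C \<noteq> {}" by blast
    show "closed ?C" using m closed_spacers by blast
    show "(shift ^^ m) ` ?C = ?C"
    proof
      show "?C \<subseteq> (shift ^^ m) ` ?C"
      proof
        fix y assume "y \<in> ?C"
        then obtain j where j: "y = spacer j" "m dvd j" by blast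
        \<comment> \<open>Adding \<open>(p - 1) * m\<close> replaces subtracting \<open>m\<close>
          modulo \<open>p\<close>.\<close>
        have "j + (p - 1) * m + m = j + p * m"
          using p_pos by (cases p) auto
        then have "y = (shift ^^ m) (spacer (j + (p - 1) * m))"
          using spacer_mod[of "j + p * m"] spacer_mod[of j] j(1)
          by (simp only: shift_funpow_spacer mod_mult_self2)
        moreover have "m dvd j + (p - 1) * m" using j by simp
        ultimately show "y \<in> (shift ^^ m) ` ?C" by blast
      qed
    qed (auto simp: shift_funpow_spacer)
    show "(shift ^^ j) ` ?C \<noteq> ?C" if j: "1 \<le> j" "j < m" for j
    proof
      assume "(shift ^^ j) ` ?C = ?C"
      moreover have "spacer j \<in> (shift ^^ j) ` ?C"
        by (rule image_eqI[of _ _ "spacer 0"]) (auto simp: shift_funpow_spacer)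
      ultimately obtain i where i: "spacer j = spacer i" "m dvd i" by auto
      have "m \<le> p" using m p_pos by (simp add: dvd_imp_le)
      then have "j = i mod p"
        using fun_cong[OF i(1), of 0] j by (simp add: spacer_def)
      then have "m dvd j" using i(2) m(1) by (simp add: dvd_mod)
      then show False using j by (auto dest: dvd_imp_le)
    qed
  qed (rule m)
qed

text \<open>The shift permutes the \<open>q\<close> phases cyclically; every \<open>m\<close>-th
  phase is taken into the closed set.\<close>

lemma divisors_of_q_periods:
  assumes m: "m dvd q" "m \<ge> 1" shows "m \<in> closed_set_periods subshift shift"
proof -
  let ?I = "{i. i < q \<and> m dvd i}"
  let ?C = "\<Union>i\<in>?I. phase_shift i"
  have C: "phase_shift i \<subseteq> ?C" if "m dvd i" for i
  proof -
    have "i mod q \<in> ?I" using that m q_pos by (simp add: dvd_mod)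
    then have "phase_shift (i mod q) \<subseteq> ?C" by (rule UN_upper)
    then show ?thesis by (simp only: phase_shift_mod)
  qed
  show ?thesis
  proof (rule closed_set_periodsI[where C = ?C])
    show "?C \<subseteq> subshift" by (auto simp: subshift_eq)
    show "closed ?C"
      using closed_phase_shift by (intro closed_UN) auto
    have "letter 0 0 \<in> ?C"
      using C[OF dvd_0_right] letter_in_phase_shift by (rule subsetD)
    then show "?C \<noteq> {}" by blast
    show "(shift ^^ m) ` ?C = ?C"
    proof
      show "(shift ^^ m) ` ?C \<subseteq> ?C"
        unfolding image_UN shift_funpow_phase_shift by (intro UN_least C) simp
      show "?C \<subseteq> (shift ^^ m) ` ?C"
      proof (rule UN_least)
        fix i assume "i \<in> ?I"
        then have "phase_shift (i + (q - 1) * m) \<subseteq> ?C" by (intro C) simp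
        moreover have "i + (q - 1) * m + m = i + q * m"
          using q_pos by (cases q) auto
        then have "(shift ^^ m) ` phase_shift (i + (q - 1) * m) = phase_shift i"
          using phase_shift_mod[of "i + q * m"] phase_shift_mod[of i]
          by (simp only: shift_funpow_phase_shift mod_mult_self2)
        ultimately show "phase_shift i \<subseteq> (shift ^^ m) ` ?C"
          using image_mono[of "phase_shift (i + (q - 1) * m)" ?C "shift ^^ m"] by simp
      qed
    qed
    show "(shift ^^ j) ` ?C \<noteq> ?C" if j: "1 \<le> j" "j < m" for j
    proof
      assume "(shift ^^ j) ` ?C = ?C"
      moreover have "phase_shift j \<subseteq> (shift ^^ j) ` ?C"
        using shift_funpow_phase_shift[of j 0] image_mono[OF C[OF dvd_0_right], of "shift ^^ j"] by simp
      ultimately have "phase_shift j \<subseteq> ?C" by (simp only:)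
      \<comment> \<open>The word \<open>letter j 0\<close> starts with a marker, whose colour
        reveals the phase \<open>j\<close>, not divisible by \<open>m\<close>.\<close>
      then have "letter j 0 \<in> ?C"
        using letter_in_phase_shift by (rule subsetD)
      then obtain i where i: "i < q" "m dvd i" "letter j 0 \<in> phase_shift i" by blast
      have "m \<le> q" using m q_pos by (simp add: dvd_imp_le)
      then have "letter j 0 0 = p + j"
        using j limit_word_0 by (simp add: letter_def)
      then have "j = i"
        using phase_shift_marker[OF i(3), of 0] i(1) by simp
      then show False using i(2) j by (auto dest: dvd_imp_le)
    qed
  qed (rule m)
qed

lemma invariant_period_p_or_q:
  assumes C: "closed C" "C \<subseteq> subshift" and k: "k \<ge> 1" "(shift ^^ k) ` C = C"
  shows "(shift ^^ p) ` C = C \<or> (shift ^^ q) ` C = C"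
proof (cases "\<exists>x\<in>C. \<exists>m. p \<le> x m")
  case False
  have "(shift ^^ p) x = x" if x: "x \<in> C" for x
  proof -
    obtain i where "x \<in> phase_shift i"
      using x C(2) subshift_eq by blast
    moreover have "x u < p" for u using False x by (meson not_le)
    ultimately have "x = spacer (x 0)" by (rule markerfree_spacer)
    moreover have "spacer (x 0 + p) = spacer (x 0)"
      using spacer_mod[of "x 0 + p"] spacer_mod[of "x 0"] by simp
    ultimately show ?thesis
      using shift_funpow_spacer[of p "x 0"] by simp
  qed
  then have "(shift ^^ p) ` C = C" by simp
  then show ?thesis ..
next
  case True
  define I where "I = {i. \<exists>x\<in>C. x \<in> phase_shift i \<and> (\<exists>m. p \<le> x m)}"
  have sub: "phase_shift i \<subseteq> C" if "i \<in> I" for i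
    using that marked_phase_subset[OF C k] unfolding I_def by blast
  have mem: "x \<in> (\<Union>i\<in>I. phase_shift i)" if x: "x \<in> C" for x
  proof -
    obtain j where j: "x \<in> phase_shift j"
      using x C(2) subshift_eq by blast
    show ?thesis
    proof (cases "\<exists>m. p \<le> x m")
      case True
      then show ?thesis using x j unfolding I_def by blast
    next
      case False
      then have "x = spacer (x 0)"
        using markerfree_spacer[OF j] by (simp add: not_le)
      \<comment> \<open>A single phase is enough to absorb the marker-free points, since every phase
        contains all spacers.\<close>
      moreover obtain i where "i \<in> I"
      proof -
        obtain y m where y: "y \<in> C" "p \<le> y m" using \<open>\<exists>x\<in>C. \<exists>m. p \<le> x m\<close> by blast
        moreover obtain i where "y \<in> phase_shift i" using y C(2) subshift_eq by blast
        ultimately show thesis using that[of i] unfolding I_def by blast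
      qed
      ultimately show ?thesis
        using spacer_in_phase_shift[of "x 0" i] by (intro UN_I[of i]) simp_all
    qed
  qed
  have "C = (\<Union>i\<in>I. phase_shift i)"
    using sub mem by blast
  then have "(shift ^^ q) ` C = C"
    using shift_funpow_q_phase_shift by (simp add: image_UN)
  then show ?thesis ..
qed

text \<open>A least period divides every period of the set, and \<open>p\<close> or \<open>q\<close>
  is such a period.\<close>

lemma closed_set_periods_subshift:
  "closed_set_periods subshift shift = {m. m \<ge> 1 \<and> (m dvd p \<or> m dvd q)}"
proof (intro subset_antisym subsetI)
  fix k assume "k \<in> closed_set_periods subshift shift"
  then obtain C where "k \<ge> 1" "C \<subseteq> subshift" "closed C" "(shift ^^ k) ` C = C"
    "\<forall>j. 1 \<le> j \<and> j < k \<longrightarrow> (shift ^^ j) ` C \<noteq> C"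
    unfolding closed_set_periods_def mem_Collect_eq by (elim conjE exE)
  then show "k \<in> {m. m \<ge> 1 \<and> (m dvd p \<or> m dvd q)}"
    using invariant_period_p_or_q[of C k] least_period_dvd[of k shift C p]
      least_period_dvd[of k shift C q] by auto
qed (use divisors_of_p_periods divisors_of_q_periods in auto)

lemma subshift_realization:
  "\<exists>(Z :: real set) g. cantor_set Z \<and> continuous_on Z g \<and> g ` Z = Z \<and>
           Per_induced Z g = closed_set_periods subshift shift"
proof (rule symbolic_system_realization)
  show "subshift \<noteq> {}"
    using letter_in_phase_shift by (auto simp: subshift_eq)
  show "closed subshift"
    unfolding subshift_def using closed_phase_shift by (intro closed_UN) auto
  \<comment> \<open>The alphabet consists of \<open>p\<close> spacers and \<open>q\<close> coloured
    markers.\<close>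
  show "subshift \<subseteq> {x. \<forall>n. x n < p + q}"
    using phase_shift_less by (auto simp: subshift_eq)
  show "\<exists>y\<in>subshift. y \<noteq> x \<and> (\<forall>u<n. y u = x u)" if "x \<in> subshift" for x n
    using that phase_shift_perfect unfolding subshift_eq by blast
qed (rule shift_subshift)

end

theorem theorem7p4:
  fixes p q :: nat
  assumes "p \<ge> 1" and "q \<ge> 1"
  shows "\<exists>(Z::real set) g. cantor_set Z \<and> continuous_on Z g \<and> g ` Z = Z \<and>
           Per_induced Z g = {m. m \<ge> 1 \<and> (m dvd p \<or> m dvd q)}"
proof -
  interpret spaced_blocks p q
    using assms by unfold_locales
  show ?thesis
    using subshift_realization closed_set_periods_subshift by simp
qed

end
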